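(* Let $0<\lambda\le 1$ and let $f\in\mathcal{U}(\lambda)$, with initial logarithmic coefficients $\gamma_1,\gamma_2$. Then: (i) if $0<\lambda\le\frac12$, then $-\frac{2\lambda+1}{4}\le |\gamma_2|-|\gamma_1|\le \frac{\lambda}{2}$; (ii) if $\frac12\le\lambda\le 1$, then $-\frac{\sqrt{2\lambda}}{2}\le |\gamma_2|-|\gamma_1|\le\frac{\lambda}{2}$. All these estimates are sharp: for each such $\lambda$, each of the bounds (lower and upper) is attained by some function in $\mathcal{U}(\lambda)$.
   Context: Let $\mathbb{D}=\{z\in\mathbb{C}:|z|<1\}$ and let $\mathcal{A}$ be the class of functions $f$ analytic in $\mathbb{D}$ with $f(0)=0$, $f'(0)=1$, i.e. $f(z)=z+a_2z^2+a_3z^3+\cdots$. The logarithmic coefficients $\gamma_n$ of $f$ are defined by $\log\frac{f(z)}{z}=2\sum_{n=1}^\infty\gamma_nz^n$ (near $z=0$, with the branch vanishing at $0$); in particular $\gamma_1=\frac{a_2}{2}$ and $\gamma_2=\frac12\left(a_3-\frac12a_2^2\right)$. For $0<\lambda\le1$, $$\mathcal{U}(\lambda)=\left\{f\in\mathcal{A}:\ \left|\left[\frac{z}{f(z)}\right]^2f'(z)-1\right|<\lambda,\ z\in\mathbb{D}\right\},$$ where $z/f(z)$ takes the value $1$ at $z=0$, and the condition is understood to include that the expression is analytic in $\mathbb{D}$ (i.e. $f(z)\neq0$ for $z\in\mathbb{D}\setminus\{0\}$). *)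

theory Defs
  imports "HOL-Complex_Analysis.Complex_Analysis"
begin

definition class_A :: "(complex \<Rightarrow> complex) set" where
  "class_A = {f. f holomorphic_on ball 0 1 \<and> f 0 = 0 \<and> deriv f 0 = 1}"

(* For f in class_A, f z / z and z / f z both have the limit 1 at the origin. *)

definition f_over_z :: "(complex \<Rightarrow> complex) \<Rightarrow> complex \<Rightarrow> complex" where
  "f_over_z f z = (if z = 0 then 1 else f z / z)"

definition z_over_f :: "(complex \<Rightarrow> complex) \<Rightarrow> complex \<Rightarrow> complex" where
  "z_over_f f z = (if z = 0 then 1 else z / f z)"

(* The condition that f has no zero in the punctured disc is explicit, since in HOL
   z / f z would silently be 0 at such a zero. *)

definition class_U :: "real \<Rightarrow> (complex \<Rightarrow> complex) set" where
  "class_U l = {f \<in> class_A.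
     (\<forall>z \<in> ball 0 1 - {0}. f z \<noteq> 0) \<and>
     (\<forall>z \<in> ball 0 1. norm ((z_over_f f z)\<^sup>2 * deriv f z - 1) < l)}"

(* log (f z / z) = 2 * (\<Sum>n\<ge>1. log_coeff f n * z ^ n) near 0. Only the germ at 0 matters;
   there f z / z is close to 1, so the principal branch Ln is the branch vanishing at 0. *)

definition log_coeff :: "(complex \<Rightarrow> complex) \<Rightarrow> nat \<Rightarrow> complex" where
  "log_coeff f n = fps_nth (fps_expansion (\<lambda>z. Ln (f_over_z f z)) 0) n / 2"

end

theory Submission
  imports Defs
begin

text \<open>Write \<open>z / f z = 1 - z * u z\<close>. Then \<open>f\<close> satisfies the defining inequality iff
  \<open>\<bar>z\<^sup>2 * u' z\<bar> < l\<close>, and \<open>\<gamma>\<^sub>1 = u 0 / 2\<close>, \<open>\<gamma>\<^sub>2 = ((u 0)\<^sup>2 + 2 * u' 0) / 4\<close>. The constraints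
  \<open>\<bar>u' 0\<bar> \<le> l\<close> and \<open>\<bar>u 0\<bar> \<le> 1 + l\<close> reduce the bounds to a one-variable optimisation in
  \<open>\<bar>u 0\<bar>\<close>, and \<open>f z = z / (1 - a * z + l * z\<^sup>2)\<close> with \<open>a = 0\<close>, \<open>1\<close>, \<open>sqrt (2 * l)\<close> are extremal.\<close>

section \<open>Logarithmic coefficients in terms of \<open>u\<close>\<close>

text \<open>Near 0, \<open>Ln (f_over_z f z)\<close> is \<open>- Ln (1 - z * u z)\<close>, with
  derivative \<open>(u z + z * deriv u z) / (1 - z * u z)\<close>. Its value and its derivative at 0
  give the two coefficients.\<close>

lemma log_coeff_one_two:
  assumes u: "u holomorphic_on ball 0 1"
    and fu: "\<And>z. z \<in> ball 0 1 \<Longrightarrow> f_over_z f z * (1 - z * u z) = 1"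
  shows "log_coeff f 1 = u 0 / 2"
    and "log_coeff f 2 = ((u 0)\<^sup>2 + 2 * deriv u 0) / 4"
proof -
  define F where "F = (\<lambda>z. Ln (f_over_z f z))"
  define v where "v = (\<lambda>z. 1 - z * u z)"
  have v: "v holomorphic_on ball 0 1"
    unfolding v_def by (intro holomorphic_intros u)
  \<comment> \<open>On \<open>S\<close> the values of \<open>v\<close> lie in the right half-plane,
    away from the branch cut, so that \<open>Ln (inverse (v z)) = - Ln (v z)\<close>.\<close>
  define S where "S = {z \<in> ball 0 1. v z \<in> {w. Re w > 0}}"
  have S: "open S" "0 \<in> S"
  proof -
    have "open (ball 0 1 \<inter> v -` {w. Re w > 0})"
      by (intro continuous_open_preimage holomorphic_on_imp_continuous_on v open_ball open_halfspace_Re_gt)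
    then show "open S" by (simp add: S_def Int_def vimage_def)
    show "0 \<in> S" by (simp add: S_def v_def)
  qed
  have Fv: "F z = - Ln (v z)" if "z \<in> S" for z
  proof -
    have z: "z \<in> ball 0 1" "Re (v z) > 0" using that by (auto simp: S_def)
    then have vn: "v z \<noteq> 0" "v z \<notin> \<real>\<^sub>\<le>\<^sub>0" by (auto simp: complex_nonpos_Reals_iff)
    have "f_over_z f z = inverse (v z)"
      using fu[OF z(1)] vn by (simp add: v_def field_simps)
    then show ?thesis unfolding F_def using Ln_inverse[OF vn(2)] by simp
  qed
  have u': "(u has_field_derivative deriv u z) (at z)" if "z \<in> S" for z
    using that by (intro holomorphic_derivI[OF u]) (auto simp: S_def)
  have evS: "eventually (\<lambda>z. z \<in> S) (nhds z)" if "z \<in> S" for z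
    using S that by (intro eventually_nhds_in_open) auto
  have dF: "deriv F z = (u z + z * deriv u z) / (1 - z * u z)" if z: "z \<in> S" for z
  proof -
    have vz: "v z \<noteq> 0" "v z \<notin> \<real>\<^sub>\<le>\<^sub>0" using z by (auto simp: S_def complex_nonpos_Reals_iff)
    have "((\<lambda>z. - Ln (1 - z * u z)) has_field_derivative
        (u z + z * deriv u z) / (1 - z * u z)) (at z)"
      using vz unfolding v_def
      by (auto intro!: derivative_eq_intros u'[OF z] simp: field_simps)
    then have "deriv (\<lambda>z. - Ln (v z)) z = (u z + z * deriv u z) / (1 - z * u z)"
      unfolding v_def by (rule DERIV_imp_deriv)
    moreover have "deriv F z = deriv (\<lambda>z. - Ln (v z)) z"
      by (intro deriv_cong_ev eventually_mono[OF evS[OF z]] Fv refl)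
    ultimately show ?thesis by simp
  qed
  have "deriv u holomorphic_on ball 0 1" by (intro holomorphic_deriv u open_ball)
  then have u'': "(deriv u has_field_derivative deriv (deriv u) 0) (at 0)"
    by (rule holomorphic_derivI) auto
  have "deriv (deriv F) 0 = deriv (\<lambda>z. (u z + z * deriv u z) / (1 - z * u z)) 0"
    by (intro deriv_cong_ev eventually_mono[OF evS[OF S(2)]] dF refl)
  also have "\<dots> = (u 0)\<^sup>2 + 2 * deriv u 0"
    by (rule DERIV_imp_deriv)
      (auto intro!: derivative_eq_intros u'[OF S(2)] u'' simp: power2_eq_square)
  finally have "deriv (deriv F) 0 = (u 0)\<^sup>2 + 2 * deriv u 0" .
  \<comment> \<open>The denominator 4 is 2! from the Taylor coefficient times the 2 in
    \<open>log_coeff\<close>.\<close>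
  then show "log_coeff f 2 = ((u 0)\<^sup>2 + 2 * deriv u 0) / 4"
    by (simp add: log_coeff_def fps_expansion_def F_def numeral_2_eq_2)
  show "log_coeff f 1 = u 0 / 2"
    using dF[OF S(2)] by (simp add: log_coeff_def fps_expansion_def F_def)
qed

section \<open>Constraints on \<open>u 0\<close> and \<open>deriv u 0\<close>\<close>

text \<open>If \<open>\<bar>u 0\<bar> > 1 + l\<close> then \<open>z \<mapsto> 1 / u z\<close> maps a closed disc inside the unit disc to itself.\<close>

lemma norm_le_of_nonvanishing:
  fixes u :: "complex \<Rightarrow> complex"
  assumes u: "continuous_on (ball 0 1) u" and "0 \<le> l"
    and nz: "\<And>z. z \<in> ball 0 1 \<Longrightarrow> 1 - z * u z \<noteq> 0"
    and ul: "\<And>z. z \<in> ball 0 1 \<Longrightarrow> norm (u z - u 0) \<le> l"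
  shows "norm (u 0) \<le> 1 + l"
proof (rule ccontr)
  assume "\<not> norm (u 0) \<le> 1 + l"
  then have a: "norm (u 0) - l > 1" by simp
  \<comment> \<open>With this radius, \<open>norm (u z) \<ge> 1 / r\<close> on the closed disc,
    which is exactly what the self-map needs.\<close>
  define r where "r = 1 / (norm (u 0) - l)"
  have r: "0 < r" "r < 1" using a by (auto simp: r_def)
  have lower: "norm (u 0) - l \<le> norm (u z)" if "z \<in> cball 0 r" for z
  proof -
    have "norm (u 0) - norm (u z) \<le> norm (u z - u 0)"
      by (metis norm_minus_commute norm_triangle_ineq2)
    also have "\<dots> \<le> l" using that r by (intro ul) auto
    finally show ?thesis by simp
  qed
  have nz': "u z \<noteq> 0" if "z \<in> cball 0 r" for z
    using lower[OF that] a by auto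
  have "continuous_on (cball 0 r) (\<lambda>z. 1 / u z)"
    using nz' r by (intro continuous_intros continuous_on_subset[OF u]) auto
  moreover have "(\<lambda>z. 1 / u z) \<in> cball 0 r \<rightarrow> cball 0 r"
  proof
    fix z :: complex assume z: "z \<in> cball 0 r"
    have "norm (1 / u z) = 1 / norm (u z)" by (simp add: norm_divide)
    also have "\<dots> \<le> r" unfolding r_def using lower[OF z] a by (intro divide_left_mono mult_pos_pos) auto
    finally show "1 / u z \<in> cball 0 r" by simp
  qed
  \<comment> \<open>Brouwer's fixed point is a zero of \<open>1 - z * u z\<close>, and it lies in
    the unit disc since \<open>r < 1\<close>.\<close>
  ultimately obtain z where z: "z \<in> cball 0 r" "1 / u z = z"
    using brouwer_ball[OF r(1)] by metis
  then have "1 - z * u z = 0" using nz' by (metis diff_self nonzero_divide_eq_eq)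
  then show False using nz[of z] z r by auto
qed

text \<open>For \<open>g z = 1 - z * u z\<close> one has \<open>g z - z * g' z - 1 = z\<^sup>2 * u' z\<close>, so the maximum
  principle turns the bound on the left into the same bound on \<open>u'\<close>.\<close>

lemma deriv_bound_of_sq_bound:
  assumes u: "u holomorphic_on ball 0 1"
    and b: "\<And>z. z \<in> ball 0 1 \<Longrightarrow> norm (z\<^sup>2 * deriv u z) \<le> l"
    and z: "z \<in> ball 0 1"
  shows "norm (deriv u z) \<le> l"
proof -
  have u': "deriv u holomorphic_on ball 0 1" by (intro holomorphic_deriv u open_ball)
  have r: "r\<^sup>2 * norm (deriv u z) \<le> l" if "norm z < r" "r < 1" for r
  proof -
    have r0: "r > 0" using that norm_ge_zero[of z] by linarith
    have sub: "cball 0 r \<subseteq> ball (0::complex) 1" using that by auto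
    have "norm (deriv u z) \<le> l / r\<^sup>2"
    proof (rule maximum_modulus_frontier[where S = "cball 0 r" and f = "deriv u"])
      show "deriv u holomorphic_on interior (cball 0 r)"
        using sub interior_subset by (intro holomorphic_on_subset[OF u']) blast
      show "continuous_on (closure (cball 0 r)) (deriv u)"
        using sub by (intro holomorphic_on_imp_continuous_on holomorphic_on_subset[OF u']) auto
      show "bounded (cball (0::complex) r)" by simp
      show "z \<in> cball 0 r" using that by simp
      fix w :: complex assume "w \<in> frontier (cball 0 r)"
      then have w: "norm w = r" using r0 by simp
      then show "norm (deriv u w) \<le> l / r\<^sup>2"
        using b[of w] that r0 by (simp add: norm_mult norm_power field_simps)
    qed
    then show ?thesis using r0 by (simp add: field_simps)
  qed
  \<comment> \<open>Letting the radius tend to 1 from below removes the factor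
    \<open>r\<^sup>2\<close>.\<close>
  have "((\<lambda>r. r\<^sup>2 * norm (deriv u z)) \<longlongrightarrow> 1\<^sup>2 * norm (deriv u z)) (at_left 1)"
    by (intro tendsto_intros)
  moreover have "eventually (\<lambda>r. r\<^sup>2 * norm (deriv u z) \<le> l) (at_left 1)"
    using eventually_at_left_real[of "norm z" 1] z by (auto elim!: eventually_mono intro: r)
  ultimately show ?thesis
    by (metis one_power2 mult_1 tendsto_upperbound trivial_limit_at_left_real)
qed

text \<open>The function \<open>u\<close> is the negated difference quotient of
  \<open>z / f z\<close> at 0. Differentiating \<open>(1 - z * u z) * f z = z\<close> turns the
  defining inequality into a bound on \<open>z\<^sup>2 * deriv u z\<close>, hence on
  \<open>deriv u\<close>. Integration then controls \<open>u z - u 0\<close>, and the nonvanishing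
  of \<open>1 - z * u z\<close> bounds \<open>u 0\<close>.\<close>

lemma class_U_repr:
  assumes f: "f \<in> class_U l" and l: "0 < l"
  obtains u where "u holomorphic_on ball 0 1"
    and "\<And>z. z \<in> ball 0 1 \<Longrightarrow> f_over_z f z * (1 - z * u z) = 1"
    and "norm (u 0) \<le> 1 + l" and "norm (deriv u 0) \<le> l"
proof -
  have hf: "f holomorphic_on ball 0 1" and f0: "f 0 = 0" "deriv f 0 = 1"
    and nz: "\<And>z. z \<in> ball 0 1 \<Longrightarrow> z \<noteq> 0 \<Longrightarrow> f z \<noteq> 0"
    and bd: "\<And>z. z \<in> ball 0 1 \<Longrightarrow> norm ((z_over_f f z)\<^sup>2 * deriv f z - 1) < l"
    using f by (auto simp: class_U_def class_A_def)
  define g where "g = z_over_f f"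
  have p: "f_over_z f holomorphic_on ball 0 1"
  proof -
    have "(\<lambda>z. if z = 0 then deriv f 0 else (f z - f 0) / (z - 0)) holomorphic_on ball 0 1"
      by (rule pole_lemma[OF hf]) auto
    then show ?thesis by (simp add: f0 f_over_z_def[abs_def] cong: if_cong)
  qed
  have pnz: "f_over_z f z \<noteq> 0" if "z \<in> ball 0 1" for z
    using nz[OF that] by (auto simp: f_over_z_def)
  have gp: "g = (\<lambda>z. 1 / f_over_z f z)"
    by (auto simp: g_def z_over_f_def f_over_z_def)
  have g: "g holomorphic_on ball 0 1"
    unfolding gp by (intro holomorphic_intros p pnz)
  have g0: "g 0 = 1" by (simp add: g_def z_over_f_def)
  define u where "u = (\<lambda>z. - (if z = 0 then deriv g 0 else (g z - g 0) / (z - 0)))"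
  have u: "u holomorphic_on ball 0 1"
    unfolding u_def by (rule holomorphic_on_minus, rule pole_lemma[OF g]) auto
  have gu: "g z = 1 - z * u z" for z by (simp add: u_def g0)
  have fg: "f_over_z f z * (1 - z * u z) = 1" if "z \<in> ball 0 1" for z
    using pnz[OF that] unfolding gu[symmetric] gp by simp
  have "norm (z\<^sup>2 * deriv u z) \<le> l" if z: "z \<in> ball 0 1" for z
  proof (cases "z = 0")
    case False
    have df: "(f has_field_derivative deriv f z) (at z)"
      by (rule holomorphic_derivI[OF hf open_ball z])
    have du: "(u has_field_derivative deriv u z) (at z)"
      by (rule holomorphic_derivI[OF u open_ball z])
    have fz: "f z \<noteq> 0" using nz z False by auto
    have gz: "g z * f z = z" using fz False by (simp add: g_def z_over_f_def)
    have "((\<lambda>z. (1 - z * u z) * f z) has_field_derivative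
        (1 - z * u z) * deriv f z - (u z + z * deriv u z) * f z) (at z)"
      by (auto intro!: derivative_eq_intros df du simp: algebra_simps)
    moreover have "eventually (\<lambda>w. (1 - w * u w) * f w = w) (nhds z)"
    proof (rule eventually_mono)
      show "eventually (\<lambda>w. w \<in> ball 0 1) (nhds z)" using z by (intro eventually_nhds_in_open) auto
      fix w :: complex assume "w \<in> ball 0 1"
      then show "(1 - w * u w) * f w = w"
        using nz[of w] by (cases "w = 0") (auto simp: gu[symmetric] g_def z_over_f_def f0)
    qed
    ultimately have "((\<lambda>w. w) has_field_derivative
        (1 - z * u z) * deriv f z - (u z + z * deriv u z) * f z) (at z)"
      by (subst (asm) DERIV_cong_ev[OF refl _ refl]) auto
    then have "(1 - z * u z) * deriv f z - (u z + z * deriv u z) * f z = 1"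
      using DERIV_unique DERIV_ident by blast
    \<comment> \<open>The extra factor \<open>g z\<close> makes \<open>f\<close> occur only in the
      product \<open>g z * f z = z\<close>.\<close>
    then have "g z * (g z * deriv f z - (u z + z * deriv u z) * f z) = g z"
      by (simp add: gu)
    then have "(g z)\<^sup>2 * deriv f z = g z + (u z + z * deriv u z) * (g z * f z)"
      by (simp add: algebra_simps power2_eq_square)
    then have "(g z)\<^sup>2 * deriv f z - 1 = z\<^sup>2 * deriv u z"
      unfolding gz by (simp add: gu algebra_simps power2_eq_square)
    then show ?thesis using bd[OF z] by (simp add: g_def)
  qed (use l in simp)
  then have du: "norm (deriv u z) \<le> l" if "z \<in> ball 0 1" for z
    using deriv_bound_of_sq_bound[OF u _ that] by blast
  have "norm (u z - u 0) \<le> l" if z: "z \<in> ball 0 1" for z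
  proof -
    have "norm (u z - u 0) \<le> l * norm (z - 0)"
      using z by (intro field_differentiable_bound[of "ball 0 1" u "deriv u"] du
          DERIV_subset[OF holomorphic_derivI[OF u open_ball]]) auto
    also have "\<dots> \<le> l * 1" using z l by (intro mult_left_mono) auto
    finally show ?thesis by simp
  qed
  moreover have "1 - z * u z \<noteq> 0" if "z \<in> ball 0 1" for z
    using fg[OF that] by auto
  ultimately have "norm (u 0) \<le> 1 + l"
    using l by (intro norm_le_of_nonvanishing holomorphic_on_imp_continuous_on u) auto
  then show ?thesis using that u fg du[of 0] by auto
qed

section \<open>Extremal functions\<close>

text \<open>A vanishing imaginary part leaves two cases. For real \<open>z\<close> the quadratic is
  at least \<open>(1 - \<bar>x\<bar>) * (1 - b * \<bar>x\<bar>) > 0\<close>; non-real roots are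
  conjugate with product \<open>1 / b \<ge> 1\<close>, so they lie outside the disc.\<close>

lemma quadratic_nonzero_in_disc:
  fixes a b :: real and z :: complex
  assumes "0 \<le> a" "a \<le> 1 + b" "0 < b" "b \<le> 1" and z: "norm z < 1"
  shows "1 - a * z + b * z\<^sup>2 \<noteq> 0"
proof
  assume eq: "1 - a * z + b * z\<^sup>2 = 0"
  define x y where "x = Re z" and "y = Im z"
  have "Re (1 - a * z + b * z\<^sup>2) = 0" "Im (1 - a * z + b * z\<^sup>2) = 0" by (simp_all only: eq zero_complex.sel)
  then have re: "1 - a * x + b * (x\<^sup>2 - y\<^sup>2) = 0" and im: "y * (2 * b * x - a) = 0"
    by (simp_all add: x_def y_def power2_eq_square algebra_simps)
  have xy: "x\<^sup>2 + y\<^sup>2 < 1"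
    using z by (simp add: x_def y_def cmod_def)
  show False
  proof (cases "y = 0")
    case True
    have x: "\<bar>x\<bar> < 1" using xy True by (simp add: abs_square_less_1)
    have "a * x \<le> a * \<bar>x\<bar>" using assms by (intro mult_left_mono) auto
    also have "\<dots> \<le> (1 + b) * \<bar>x\<bar>" using assms by (intro mult_right_mono) auto
    finally have "a * x \<le> (1 + b) * \<bar>x\<bar>" .
    then have "(1 - \<bar>x\<bar>) * (1 - b * \<bar>x\<bar>) \<le> 1 - a * x + b * x\<^sup>2"
      by (simp add: algebra_simps power2_eq_square)
    moreover have "b * \<bar>x\<bar> \<le> 1 * \<bar>x\<bar>" using assms by (intro mult_right_mono) auto
    then have "(1 - \<bar>x\<bar>) * (1 - b * \<bar>x\<bar>) > 0"
      using x by (intro mult_pos_pos) auto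
    ultimately show False using re True by simp
  next
    case False
    then have "a = 2 * b * x" using im by simp
    then have "b * (x\<^sup>2 + y\<^sup>2) = 1" using re by (simp add: algebra_simps power2_eq_square)
    moreover have "b * (x\<^sup>2 + y\<^sup>2) \<le> 1 * (x\<^sup>2 + y\<^sup>2)" using assms by (intro mult_right_mono) auto
    ultimately show False using xy by simp
  qed
qed

text \<open>Here \<open>u z = a - l * z\<close>, so
  \<open>z\<^sup>2 * deriv u z = - l * z\<^sup>2\<close> has modulus below \<open>l\<close> in the
  disc, while \<open>deriv u 0 = - l\<close> has the largest admissible modulus.\<close>

lemma quadratic_denominator_class_U:
  fixes a l :: real
  assumes "0 \<le> a" "a \<le> 1 + l" "0 < l" "l \<le> 1"
  defines "f \<equiv> \<lambda>z::complex. z / (1 - a * z + l * z\<^sup>2)"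
  shows "f \<in> class_U l"
    and "norm (log_coeff f 2) - norm (log_coeff f 1) = \<bar>a\<^sup>2 - 2 * l\<bar> / 4 - a / 2"
proof -
  have nz: "1 - a * z + l * z\<^sup>2 \<noteq> 0" if "z \<in> ball 0 1" for z :: complex
    using that quadratic_nonzero_in_disc assms by simp
  have hol: "f holomorphic_on ball 0 1"
    unfolding f_def by (intro holomorphic_intros nz)
  have df: "deriv f z = (1 - l * z\<^sup>2) / (1 - a * z + l * z\<^sup>2)\<^sup>2" if "z \<in> ball 0 1" for z :: complex
    unfolding f_def using nz[OF that]
    by (intro DERIV_imp_deriv)
      (auto intro!: derivative_eq_intros simp: power2_eq_square algebra_simps)
  have "norm ((z_over_f f z)\<^sup>2 * deriv f z - 1) < l" if z: "z \<in> ball 0 1" for z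
  proof -
    have zf: "z_over_f f z = 1 - a * z + l * z\<^sup>2"
      by (auto simp: z_over_f_def f_def)
    have "(z_over_f f z)\<^sup>2 * deriv f z = 1 - l * z\<^sup>2"
      unfolding zf df[OF z] using nz[OF z] by simp
    then have "norm ((z_over_f f z)\<^sup>2 * deriv f z - 1) = l * (norm z)\<^sup>2"
      using assms by (simp add: norm_mult norm_power)
    also have "\<dots> < l * 1"
      using assms z by (intro mult_strict_left_mono) (auto simp: abs_square_less_1)
    finally show ?thesis by simp
  qed
  then show "f \<in> class_U l"
    using hol nz df[of 0] by (auto simp: class_U_def class_A_def) (auto simp: f_def)
  define u where "u = (\<lambda>z::complex. a - l * z)"
  have "u holomorphic_on ball 0 1" unfolding u_def by (intro holomorphic_intros)
  moreover have "f_over_z f z * (1 - z * u z) = 1" if "z \<in> ball 0 1" for z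
  proof -
    have "1 - z * u z = 1 - a * z + l * z\<^sup>2"
      by (simp add: u_def algebra_simps power2_eq_square)
    then show ?thesis using nz[OF that] by (simp add: f_over_z_def f_def)
  qed
  ultimately have lc: "log_coeff f 1 = u 0 / 2" "log_coeff f 2 = ((u 0)\<^sup>2 + 2 * deriv u 0) / 4"
    using log_coeff_one_two by blast+
  have "deriv u 0 = - l"
    unfolding u_def by (rule DERIV_imp_deriv) (auto intro!: derivative_eq_intros)
  then have "log_coeff f 2 = of_real ((a\<^sup>2 - 2 * l) / 4)" "log_coeff f 1 = of_real (a / 2)"
    using lc by (simp_all add: u_def)
  then have "norm (log_coeff f 2) = \<bar>(a\<^sup>2 - 2 * l) / 4\<bar>" "norm (log_coeff f 1) = \<bar>a / 2\<bar>"
    by (simp_all only: norm_of_real)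
  then show "norm (log_coeff f 2) - norm (log_coeff f 1) = \<bar>a\<^sup>2 - 2 * l\<bar> / 4 - a / 2"
    using assms by simp
qed

section \<open>The estimates and their sharpness\<close>

text \<open>With \<open>x = norm (u 0)\<close>, the difference is \<open>n / 4 - x / 2\<close>,
  where the triangle inequality puts \<open>n\<close> within \<open>2 * l\<close> of
  \<open>x\<^sup>2\<close>. What remains is elementary optimisation over
  \<open>0 \<le> x \<le> 2\<close>.\<close>

lemma class_U_bounds:
  assumes f: "f \<in> class_U l" and l: "0 < l" "l \<le> 1"
  defines "d \<equiv> norm (log_coeff f 2) - norm (log_coeff f 1)"
  shows "d \<le> l / 2" and "- ((2 * l + 1) / 4) \<le> d"
    and "1/2 \<le> l \<Longrightarrow> - (sqrt (2 * l) / 2) \<le> d"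
proof -
  obtain u where u: "u holomorphic_on ball 0 1"
    "\<And>z. z \<in> ball 0 1 \<Longrightarrow> f_over_z f z * (1 - z * u z) = 1"
    and a: "norm (u 0) \<le> 1 + l" and du: "norm (deriv u 0) \<le> l"
    using class_U_repr[OF f l(1)] by blast
  define x where "x = norm (u 0)"
  have lc: "log_coeff f 1 = u 0 / 2" "log_coeff f 2 = ((u 0)\<^sup>2 + 2 * deriv u 0) / 4"
    by (rule log_coeff_one_two[OF u]; assumption)+
  define n where "n = norm ((u 0)\<^sup>2 + 2 * deriv u 0)"
  have d: "d = n / 4 - x / 2" unfolding d_def lc by (simp add: norm_divide x_def n_def)
  have x: "0 \<le> x" "x \<le> 2" using a l by (auto simp: x_def)
  have n: "n \<le> x\<^sup>2 + 2 * l" "x\<^sup>2 - 2 * l \<le> n" "0 \<le> n"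
  proof -
    have "n \<le> norm ((u 0)\<^sup>2) + norm (2 * deriv u 0)" unfolding n_def by (rule norm_triangle_ineq)
    then show "n \<le> x\<^sup>2 + 2 * l" using du by (simp add: x_def norm_power norm_mult)
    have "norm ((u 0)\<^sup>2) - norm (2 * deriv u 0) \<le> n" unfolding n_def by (rule norm_diff_ineq)
    then show "x\<^sup>2 - 2 * l \<le> n" using du by (simp add: x_def norm_power norm_mult)
  qed (simp add: n_def)
  have "x * x \<le> 2 * x" using x by (intro mult_right_mono) auto
  then show "d \<le> l / 2" using n by (simp add: d power2_eq_square)
  \<comment> \<open>The lower estimate \<open>(x\<^sup>2 - 2 * l) / 4 - x / 2\<close> is smallest at
    \<open>x = 1\<close>.\<close>
  have "(x - 1)\<^sup>2 \<ge> 0" by simp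
  then have "2 * x \<le> x\<^sup>2 + 1" by (simp add: power2_eq_square algebra_simps)
  then show "- ((2 * l + 1) / 4) \<le> d"
    using n by (simp add: d field_simps)
  define s where "s = sqrt (2 * l)"
  have s: "s\<^sup>2 = 2 * l" "s \<ge> 0" using l by (auto simp: s_def)
  assume "1/2 \<le> l"
  then have s1: "s \<ge> 1" by (simp add: s_def)
  have "- (s / 2) \<le> d"
  \<comment> \<open>Up to \<open>s\<close>, the bound \<open>n \<ge> 0\<close> suffices. Beyond it,
    \<open>n \<ge> x\<^sup>2 - s\<^sup>2\<close> is used, and \<open>x\<^sup>2 / 4 - x / 2\<close>
    increases there because \<open>s \<ge> 1\<close>.\<close>
  proof (cases "x \<le> s")
    case True
    then show ?thesis using n by (simp add: d)
  next
    case False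
    then have "0 \<le> (x - s) * (x + s - 2)" using s1 by (intro mult_nonneg_nonneg) auto
    then have "2 * x - 2 * s \<le> x\<^sup>2 - s\<^sup>2" by (simp add: algebra_simps power2_eq_square)
    then show ?thesis using n s by (simp add: d)
  qed
  then show "- (sqrt (2 * l) / 2) \<le> d" by (simp add: s_def)
qed

theorem theorem1:
  fixes l :: real
  assumes "0 < l" and "l \<le> 1"
  shows
    "(l \<le> 1/2 \<longrightarrow>
       (\<forall>f \<in> class_U l.
          - ((2 * l + 1) / 4) \<le> norm (log_coeff f 2) - norm (log_coeff f 1) \<and>
          norm (log_coeff f 2) - norm (log_coeff f 1) \<le> l / 2) \<and>
       (\<exists>f \<in> class_U l. norm (log_coeff f 2) - norm (log_coeff f 1) = - ((2 * l + 1) / 4)) \<and>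
       (\<exists>f \<in> class_U l. norm (log_coeff f 2) - norm (log_coeff f 1) = l / 2)) \<and>
     (1/2 \<le> l \<longrightarrow>
       (\<forall>f \<in> class_U l.
          - (sqrt (2 * l) / 2) \<le> norm (log_coeff f 2) - norm (log_coeff f 1) \<and>
          norm (log_coeff f 2) - norm (log_coeff f 1) \<le> l / 2) \<and>
       (\<exists>f \<in> class_U l. norm (log_coeff f 2) - norm (log_coeff f 1) = - (sqrt (2 * l) / 2)) \<and>
       (\<exists>f \<in> class_U l. norm (log_coeff f 2) - norm (log_coeff f 1) = l / 2))"
proof -
  have "\<exists>f \<in> class_U l. norm (log_coeff f 2) - norm (log_coeff f 1) = l / 2"
    using quadratic_denominator_class_U[of 0 l] assms by fastforce
  moreover have "\<exists>f \<in> class_U l. norm (log_coeff f 2) - norm (log_coeff f 1) = - ((2 * l + 1) / 4)"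
    if "l \<le> 1/2"
  proof -
    have "\<bar>1\<^sup>2 - 2 * l\<bar> / 4 - 1 / 2 = - ((2 * l + 1) / 4)"
      using that by (simp add: field_simps)
    then show ?thesis using quadratic_denominator_class_U[of 1 l] assms by fastforce
  qed
  moreover have "\<exists>f \<in> class_U l. norm (log_coeff f 2) - norm (log_coeff f 1) = - (sqrt (2 * l) / 2)"
  proof -
    \<comment> \<open>The choice \<open>a = sqrt (2 * l)\<close> makes the second coefficient
      vanish; this inequality shows that it satisfies \<open>a \<le> 1 + l\<close>.\<close>
    have "2 * l \<le> (1 + l)\<^sup>2" by (simp add: power2_eq_square algebra_simps)
    then have "sqrt (2 * l) \<le> 1 + l" using assms by (intro real_le_lsqrt) auto
    moreover have "\<bar>(sqrt (2 * l))\<^sup>2 - 2 * l\<bar> / 4 - sqrt (2 * l) / 2 = - (sqrt (2 * l) / 2)"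
      using assms by simp
    ultimately show ?thesis using quadratic_denominator_class_U[of "sqrt (2 * l)" l] assms by fastforce
  qed
  ultimately show ?thesis
    using class_U_bounds[OF _ assms] by blast
qed

end
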